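(* Let $I$ be an input with no duplicate elements. Every run written by the greedy algorithm (buffer size $M$) on $I$, except the last two runs, has length at least $M+\lceil\lfloor M/2\rfloor/2\rceil$.
   Context: Up-down run generation problem: an input stream $I$ of $N$ elements from a totally ordered set is presented in order to an algorithm with a buffer of $M$ slots; the algorithm reads elements in order into the buffer and writes elements from the buffer to an output sequence, each write freeing a slot that is filled by the next input element. A run is a sorted or reverse-sorted sequence. A maximal increasing run is written as follows: start with the smallest element in the buffer, always write the smallest buffered element larger than the last element written, and end the run only when every buffered element is smaller than the last element written; a maximal decreasing run is symmetric. A decision point is the start or any time a run has just ended. The greedy algorithm is the (offline) algorithm that, at each decision point, determines the lengths of the maximal increasing run and the maximal decreasing run that could be written next and writes the longer one (ties broken arbitrarily). *)

theory Defs
  imports Complex_Main "HOL-Library.Multiset"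
begin

text \<open>A state pairs the contents of the buffer with the part of the input not yet read.\<close>

type_synonym 'a state = "'a multiset \<times> 'a list"

definition init_state :: "nat \<Rightarrow> 'a list \<Rightarrow> 'a state" where
  "init_state M I = (mset (take M I), drop M I)"

text \<open>Writing removes an element from the buffer; the freed slot is refilled at once, as long as
  input is left. Hence the buffer holds \<open>M\<close> elements until the input is exhausted.\<close>

fun write_element :: "'a \<Rightarrow> 'a state \<Rightarrow> 'a state" where
  "write_element x (B, []) = (B - {#x#}, [])"
| "write_element x (B, y # ys) = (add_mset y (B - {#x#}), ys)"

text \<open>Increasing and decreasing runs are treated uniformly: \<open>r\<close> is the strict order \<open>(<)\<close> for
  increasing runs and \<open>(>)\<close> for decreasing ones. \<open>continue_run r l s ws s'\<close> says that, if \<open>l\<close> is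
  the last element written and \<open>s\<close> the current state, then \<open>ws\<close> is the rest of the maximal run
  and \<open>s'\<close> the state in which it ends. In the absence of duplicates \<open>l\<close> does not occur in the
  buffer, so the condition in \<open>stop\<close> means that every buffered element precedes \<open>l\<close>.\<close>

inductive continue_run ::
    "('a \<Rightarrow> 'a \<Rightarrow> bool) \<Rightarrow> 'a \<Rightarrow> 'a state \<Rightarrow> 'a list \<Rightarrow> 'a state \<Rightarrow> bool" for r where
  stop: "(\<forall>y\<in>#B. \<not> r l y) \<Longrightarrow> continue_run r l (B, xs) [] (B, xs)"
| step: "x \<in># B \<Longrightarrow> r l x \<Longrightarrow> (\<forall>y\<in>#B. r l y \<longrightarrow> \<not> r y x) \<Longrightarrow>
         continue_run r x (write_element x (B, xs)) ws s' \<Longrightarrow> continue_run r l (B, xs) (x # ws) s'"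

inductive maximal_run ::
    "('a \<Rightarrow> 'a \<Rightarrow> bool) \<Rightarrow> 'a state \<Rightarrow> 'a list \<Rightarrow> 'a state \<Rightarrow> bool" for r where
  start: "x \<in># B \<Longrightarrow> (\<forall>y\<in>#B. \<not> r y x) \<Longrightarrow>
          continue_run r x (write_element x (B, xs)) ws s' \<Longrightarrow> maximal_run r (B, xs) (x # ws) s'"

abbreviation maximal_increasing_run ::
    "'a::linorder state \<Rightarrow> 'a list \<Rightarrow> 'a state \<Rightarrow> bool" where
  "maximal_increasing_run \<equiv> maximal_run (<)"

abbreviation maximal_decreasing_run ::
    "'a::linorder state \<Rightarrow> 'a list \<Rightarrow> 'a state \<Rightarrow> bool" where
  "maximal_decreasing_run \<equiv> maximal_run (>)"

text \<open>A relation rather than a function, because ties are broken arbitrarily: \<open>greedy_runs s rs\<close>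
  says that \<open>rs\<close> is a possible sequence of runs written from the decision point \<open>s\<close> onwards.\<close>

inductive greedy_runs :: "'a::linorder state \<Rightarrow> 'a list list \<Rightarrow> bool" where
  finished: "greedy_runs ({#}, []) []"
| up: "maximal_increasing_run s u s\<^sub>u \<Longrightarrow> maximal_decreasing_run s d s\<^sub>d \<Longrightarrow>
       length d \<le> length u \<Longrightarrow> greedy_runs s\<^sub>u rs \<Longrightarrow> greedy_runs s (u # rs)"
| down: "maximal_increasing_run s u s\<^sub>u \<Longrightarrow> maximal_decreasing_run s d s\<^sub>d \<Longrightarrow>
       length u \<le> length d \<Longrightarrow> greedy_runs s\<^sub>d rs \<Longrightarrow> greedy_runs s (d # rs)"

definition greedy_output :: "nat \<Rightarrow> 'a::linorder list \<Rightarrow> 'a list list \<Rightarrow> bool" where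
  "greedy_output M I rs \<longleftrightarrow> greedy_runs (init_state M I) rs"

end

theory Submission
  imports Defs
begin

text \<open>Let \<open>h = \<lfloor>M/2\<rfloor>\<close>, and let \<open>L\<close> and \<open>H\<close> be the \<open>h\<close> smallest and the \<open>h\<close> largest elements of the
  buffer at a decision point. Both candidate runs write the whole buffer. The first \<open>h\<close> elements
  of the increasing run do not exceed \<open>max L\<close>, so this run also writes each of the next \<open>h\<close>
  input elements that exceeds \<open>max L\<close>; symmetrically, the decreasing run also writes those below
  \<open>min H\<close>. Every input element is of one of these two kinds, so the longer run gains at least
  \<open>\<lceil>h/2\<rceil>\<close> elements. If fewer than \<open>h\<close> input elements are left, two more runs suffice to write
  everything, because every run writes the buffer it started with.\<close>

section \<open>Invariants of the buffer and the unread input\<close>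

definition pending :: "'a state \<Rightarrow> 'a multiset" where
  "pending s = fst s + mset (snd s)"

text \<open>Distinctness is imposed on buffer and unread input together, so that it survives
  refilling.\<close>

definition buffer_inv :: "nat \<Rightarrow> 'a state \<Rightarrow> bool" where
  "buffer_inv M s \<longleftrightarrow> (\<forall>y. count (pending s) y \<le> 1) \<and> size (fst s) \<le> M \<and>
     (snd s \<noteq> [] \<longrightarrow> size (fst s) = M)"

lemma pending_write_element:
  assumes "x \<in># fst s"
  shows "pending s = add_mset x (pending (write_element x s))"
  using assms by (cases "(x, s)" rule: write_element.cases) (auto simp: pending_def)

lemma buffer_inv_write_element:
  assumes "buffer_inv M s" "x \<in># fst s"
  shows "buffer_inv M (write_element x s)"
proof -
  have "count (pending (write_element x s)) y \<le> 1" for y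
  proof -
    have "count (pending (write_element x s)) y \<le> count (pending s) y"
      by (simp add: pending_write_element[OF assms(2)])
    also have "\<dots> \<le> 1" using assms(1) by (simp add: buffer_inv_def)
    finally show ?thesis .
  qed
  moreover have "size (fst (write_element x s)) \<le> M \<and>
     (snd (write_element x s) \<noteq> [] \<longrightarrow> size (fst (write_element x s)) = M)"
    using assms
    by (cases "(x, s)" rule: write_element.cases)
      (auto simp: buffer_inv_def size_Diff_singleton dest: multi_member_split)
  ultimately show ?thesis by (simp add: buffer_inv_def)
qed

lemma continue_run_pending:
  assumes "continue_run r l s ws s'" "buffer_inv M s"
  shows "pending s = mset ws + pending s' \<and> buffer_inv M s'"
  using assms
  by (induction rule: continue_run.induct)
    (auto simp: buffer_inv_write_element pending_write_element)

lemma maximal_run_pending: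
  assumes "maximal_run r s ws s'" "buffer_inv M s"
  shows "pending s = mset ws + pending s'" "buffer_inv M s'"
  using assms
  by (auto elim!: maximal_run.cases dest!: continue_run_pending[where M = M]
      simp: buffer_inv_write_element pending_write_element)

section \<open>Lower bounds on the length of a run\<close>

text \<open>One written element costs one of the \<open>k\<close> buffered elements outside \<open>U\<close>, and while such
  elements remain, an input element in \<open>U\<close> is read early enough to join the run. The predicate
  \<open>P\<close> selects what the run may still write: everything at its start, \<open>r l\<close> after \<open>l\<close>.\<close>

lemma write_element_gain:
  assumes r: "irreflp r" "totalp r"
    and inv: "buffer_inv M (B, xs)"
    and x: "x \<in># B" "P x" "\<forall>y\<in>#B. P y \<longrightarrow> \<not> r y x"
    and P: "\<forall>y. r x y \<longrightarrow> P y"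
    and U: "\<forall>y z. U y \<longrightarrow> r y z \<longrightarrow> U z"
    and k: "k \<le> size {#y \<in># B. P y \<and> \<not> U y#}"
    and s': "write_element x (B, xs) = (B', xs')"
  shows "k - 1 \<le> size {#y \<in># B'. r x y \<and> \<not> U y#}"
    and "size {#y \<in># B. P y#} + length (filter U (take k xs)) \<le>
      Suc (size {#y \<in># B'. r x y#} + length (filter U (take (k - 1) xs')))"
proof -
  define C where "C = B - {#x#}"
  have B: "B = add_mset x C" using x(1) by (simp add: C_def)
  have "count (pending (B, xs)) x \<le> 1" using inv by (simp add: buffer_inv_def)
  then have xC: "x \<notin># C"
    by (auto simp: pending_def B not_in_iff)
  \<comment> \<open>Since \<open>x\<close> occurs only once and is \<open>r\<close>-least among the
    elements satisfying \<open>P\<close>, all others of them come after it.\<close>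
  have C: "P y \<longleftrightarrow> r x y" if "y \<in># C" for y
  proof
    assume "P y"
    moreover have "x \<noteq> y" using that xC by blast
    ultimately show "r x y" using that x(3) r(2) B by (auto simp: totalp_on_def)
  qed (use P in blast)
  have xx: "\<not> r x x" using r(1) by (simp add: irreflp_on_def)
  have eqP: "{#y \<in># B. P y#} = add_mset x {#y \<in># C. r x y#}"
    using C x(2) by (auto simp: B intro: filter_mset_cong)
  have eqPU: "{#y \<in># C. P y \<and> \<not> U y#} = {#y \<in># C. r x y \<and> \<not> U y#}"
    using C by (auto intro: filter_mset_cong)
  have kC: "k - 1 \<le> size {#y \<in># C. r x y \<and> \<not> U y#}"
    using k eqPU by (auto simp: B split: if_splits)
  \<comment> \<open>A buffered \<open>y\<close> outside \<open>U\<close> forces \<open>x\<close>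
    outside \<open>U\<close>, because \<open>U\<close> is closed along \<open>r\<close>. Every
    \<open>e\<close> in \<open>U\<close> then comes after \<open>x\<close>, so it can still join the
    run if it is read now.\<close>
  have late: "r x e" if "0 < k" "U e" for e
  proof -
    from \<open>0 < k\<close> k have "0 < size {#y \<in># B. P y \<and> \<not> U y#}" by linarith
    then obtain y where "y \<in># {#y \<in># B. P y \<and> \<not> U y#}"
      unfolding nonempty_has_size[symmetric] by (rule multiset_nonemptyE)
    then have y: "y \<in># B" "P y" "\<not> U y" by simp_all
    have "\<not> U x"
      using y x(3) U r(2) unfolding totalp_on_def by (metis UNIV_I)
    then show ?thesis
      using \<open>U e\<close> U r(2) unfolding totalp_on_def by (metis UNIV_I)
  qed
  show "k - 1 \<le> size {#y \<in># B'. r x y \<and> \<not> U y#}"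
    using s' kC by (cases xs) (auto simp: C_def[symmetric])
  show "size {#y \<in># B. P y#} + length (filter U (take k xs)) \<le>
      Suc (size {#y \<in># B'. r x y#} + length (filter U (take (k - 1) xs')))"
    using s' late by (cases xs; cases k) (auto simp: C_def[symmetric] eqP)
qed

text \<open>Each write lowers the left-hand side by at most one, by the gain lemma with
  \<open>P = r l\<close>. As \<open>k\<close> drops along with it, the induction generalizes over
  \<open>k\<close>.\<close>

lemma length_continue_run_ge:
  assumes "continue_run r l s ws s'"
    and "irreflp r" "totalp r" "transp r"
    and "buffer_inv M s"
    and "\<forall>y z. U y \<longrightarrow> r y z \<longrightarrow> U z"
    and "k \<le> size {#y \<in># fst s. r l y \<and> \<not> U y#}"
  shows "size {#y \<in># fst s. r l y#} + length (filter U (take k (snd s))) \<le> length ws"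
  using assms(1,5,7)
proof (induction arbitrary: k rule: continue_run.induct)
  case (stop B l xs)
  then have empty: "{#y \<in># B. r l y#} = {#}" "{#y \<in># B. r l y \<and> \<not> U y#} = {#}"
    by auto
  \<comment> \<open>No buffered element comes after \<open>l\<close> when the run ends, so the
    budget \<open>k\<close> is used up.\<close>
  have "k = 0" using stop.prems(2) unfolding fst_conv empty(2) by simp
  then show ?case by (simp add: empty(1))
next
  case (step x B l xs ws s')
  obtain B' xs' where w: "write_element x (B, xs) = (B', xs')" by fastforce
  have P: "\<forall>y. r x y \<longrightarrow> r l y"
    using step.hyps(2) assms(4) by (blast dest: transpD)
  have k: "k \<le> size {#y \<in># B. r l y \<and> \<not> U y#}" using step.prems(2) by simp
  note gain = write_element_gain[where P = "r l", OF assms(2,3) step.prems(1) step.hyps(1-3) P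
      assms(6) k w]
  have "buffer_inv M (B', xs')"
    using buffer_inv_write_element[OF step.prems(1), of x] step.hyps(1) w by simp
  with step.IH[of "k - 1"] gain w show ?case by simp
qed

text \<open>The first write has no predecessor to respect, so it is one gain step with
  \<open>P\<close> always true; the rest is a continued run with budget
  \<open>k - 1\<close>.\<close>

lemma length_maximal_run_ge:
  assumes "maximal_run r s ws s'"
    and "irreflp r" "totalp r" "transp r"
    and "buffer_inv M s"
    and "\<forall>y z. U y \<longrightarrow> r y z \<longrightarrow> U z"
    and "k \<le> size {#y \<in># fst s. \<not> U y#}"
  shows "size (fst s) + length (filter U (take k (snd s))) \<le> length ws"
  using assms(1)
proof cases
  case (start x B xs ws')
  obtain B' xs' where w: "write_element x (B, xs) = (B', xs')" by fastforce
  have inv: "buffer_inv M (B, xs)" using assms(5) start(1) by simp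
  have min: "\<forall>y\<in>#B. True \<longrightarrow> \<not> r y x" using start(4) by blast
  have k: "k \<le> size {#y \<in># B. True \<and> \<not> U y#}" using assms(7) start(1) by simp
  note gain = write_element_gain[where P = "\<lambda>_. True", OF assms(2,3) inv start(3) TrueI min _
      assms(6) k w]
  have "buffer_inv M (B', xs')"
    using buffer_inv_write_element[OF inv, of x] start(3) w by simp
  with length_continue_run_ge[OF start(5) assms(2-4) _ assms(6), of M "k - 1"] gain start(1,2) w
  show ?thesis by simp
qed

lemma size_buffer_le_length_maximal_run:
  assumes "maximal_run r s ws s'" "irreflp r" "totalp r" "transp r" "buffer_inv M s"
  shows "size (fst s) \<le> length ws"
  using length_maximal_run_ge[OF assms, of "\<lambda>_. True" 0] by simp

section \<open>Number of remaining runs\<close>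

lemmas less_order = irreflp_on_less totalp_on_less transp_on_less
lemmas greater_order = irreflp_on_greater totalp_on_greater transp_on_greater

text \<open>While input is left, the buffer is full and the run removes at least \<open>M\<close>
  elements; otherwise the run writes all that is pending.\<close>

lemma size_pending_after_run:
  assumes "maximal_run r s ws s'" "irreflp r" "totalp r" "transp r" "buffer_inv M s"
    and "size (pending s) \<le> Suc k * M"
  shows "size (pending s') \<le> k * M"
proof -
  have "size (pending s) = length ws + size (pending s')"
    using maximal_run_pending(1)[OF assms(1,5)] by simp
  moreover have "size (pending s) = size (fst s) + length (snd s)"
    by (simp add: pending_def)
  ultimately show ?thesis
    using assms(5,6) size_buffer_le_length_maximal_run[OF assms(1-5)]
    by (cases "snd s = []") (auto simp: buffer_inv_def)
qed

lemma length_greedy_runs_le: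
  assumes "greedy_runs s rs" "buffer_inv M s" "size (pending s) \<le> k * M"
  shows "length rs \<le> k"
  using assms
proof (induction arbitrary: k rule: greedy_runs.induct)
  case finished
  then show ?case by simp
next
  case (up s u su d sd rs)
  then have "pending s \<noteq> {#}"
    by (auto simp: pending_def elim!: maximal_run.cases)
  then obtain k' where "k = Suc k'" using up.prems by (cases k) auto
  then show ?case
    using up.IH[OF maximal_run_pending(2)[OF up.hyps(1) up.prems(1)], of k']
      size_pending_after_run[OF up.hyps(1) less_order up.prems(1), of k'] up.prems by simp
next
  case (down s u su d sd rs)
  then have "pending s \<noteq> {#}"
    by (auto simp: pending_def elim!: maximal_run.cases)
  then obtain k' where "k = Suc k'" using down.prems by (cases k) auto
  then show ?case
    using down.IH[OF maximal_run_pending(2)[OF down.hyps(2) down.prems(1)], of k']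
      size_pending_after_run[OF down.hyps(2) greater_order down.prems(1), of k'] down.prems by simp
qed

section \<open>The gain of the longer run\<close>

lemma ex_separated_halves:
  fixes B :: "'a::linorder multiset"
  assumes "\<And>y. count B y \<le> 1" "2 * h \<le> size B"
  obtains L H where "L \<subseteq># B" "H \<subseteq># B" "size L = h" "size H = h"
    "\<And>a b. a \<in># L \<Longrightarrow> b \<in># H \<Longrightarrow> a < b"
proof -
  define bs where "bs = sorted_list_of_multiset B"
  \<comment> \<open>The last \<open>h\<close> elements in sorted order start at index
    \<open>n\<close>. As \<open>h \<le> n\<close>, they do not overlap the first
    \<open>h\<close>.\<close>
  define n where "n = size B - h"
  have B: "mset bs = B" by (simp add: bs_def)
  then have len: "length bs = size B" by (metis size_mset)
  have "distinct bs"
    unfolding distinct_count_atmost_1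
  proof
    fix a
    have "count (mset bs) a \<le> 1" using assms(1) B by simp
    then show "count (mset bs) a = (if a \<in> set bs then 1 else 0)"
      by (metis One_nat_def B count_eq_zero_iff le_SucE le_zero_eq set_mset_mset)
  qed
  then have sorted: "sorted_wrt (<) bs"
    by (simp add: strict_sorted_iff bs_def)
  show thesis
  proof
    have "mset (take h bs) + mset (drop h bs) = B"
      using B by (metis append_take_drop_id mset_append)
    then show "mset (take h bs) \<subseteq># B" by (metis mset_subset_eq_add_left)
    have "mset (take n bs) + mset (drop n bs) = B"
      using B by (metis append_take_drop_id mset_append)
    then show "mset (drop n bs) \<subseteq># B" by (metis mset_subset_eq_add_right)
    show "size (mset (take h bs)) = h" "size (mset (drop n bs)) = h"
      using assms(2) by (auto simp: len n_def)
    fix a b assume "a \<in># mset (take h bs)" "b \<in># mset (drop n bs)"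
    moreover have "h \<le> n" using assms(2) by (simp add: n_def)
    ultimately have "a \<in> set (take n bs)" "b \<in> set (drop n bs)"
      using set_take_subset_set_take[of h n bs] by auto
    then show "a < b"
      using sorted append_take_drop_id[of n bs] sorted_wrt_append[of "(<)" "take n bs" "drop n bs"]
      by auto
  qed
qed

lemma longer_run_ge:
  fixes s :: "'a::linorder state"
  assumes "maximal_increasing_run s u su" "maximal_decreasing_run s d sd"
    and inv: "buffer_inv M s" and long: "2 * M < size (pending s)"
  shows "M + (M div 2 + 1) div 2 \<le> max (length u) (length d)"
proof -
  define h where "h = M div 2"
  obtain B xs where s: "s = (B, xs)" by fastforce
  have B: "size B = M" and xs: "h \<le> length xs"
    using inv long by (cases "xs = []"; auto simp: s h_def buffer_inv_def pending_def)+
  have "count B y \<le> 1" for y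
  proof -
    have "count (pending s) y \<le> 1" using inv by (simp add: buffer_inv_def)
    then show ?thesis by (simp add: s pending_def)
  qed
  moreover have "2 * h \<le> size B" by (simp add: B h_def)
  ultimately obtain L H where LH: "L \<subseteq># B" "H \<subseteq># B" "size L = h" "size H = h"
    "\<And>a b. a \<in># L \<Longrightarrow> b \<in># H \<Longrightarrow> a < b"
    using ex_separated_halves by metis
  \<comment> \<open>Quantifying over \<open>L\<close> and \<open>H\<close> instead of using their
    extrema also covers \<open>h = 0\<close>, where both are empty.\<close>
  define above where "above z \<longleftrightarrow> (\<forall>a\<in>#L. a < z)" for z
  define below where "below z \<longleftrightarrow> (\<forall>b\<in>#H. z < b)" for z
  have "{#y \<in># L. \<not> above y#} = L" "{#y \<in># H. \<not> below y#} = H"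
    by (auto simp: filter_mset_eq_conv above_def below_def)
  then have "L \<subseteq># {#y \<in># B. \<not> above y#}" "H \<subseteq># {#y \<in># B. \<not> below y#}"
    using LH(1,2) by (metis multiset_filter_mono)+
  then have h: "h \<le> size {#y \<in># B. \<not> above y#}" "h \<le> size {#y \<in># B. \<not> below y#}"
    using LH(3,4) by (auto dest!: size_mset_mono)
  have up: "\<forall>y z. above y \<longrightarrow> y < z \<longrightarrow> above z"
    and down: "\<forall>y z. below y \<longrightarrow> z < y \<longrightarrow> below z"
    unfolding above_def below_def by (blast intro: less_trans)+
  have "M + length (filter above (take h xs)) \<le> length u"
    using length_maximal_run_ge[OF assms(1) less_order inv, of above h] h(1) up
    by (simp add: s B)
  moreover have "M + length (filter below (take h xs)) \<le> length d"
    using length_maximal_run_ge[OF assms(2) greater_order inv, of below h] h(2) down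
    by (simp add: s B)
  moreover have "h \<le> length (filter above (take h xs)) + length (filter below (take h xs))"
  proof -
    \<comment> \<open>If both failed, some \<open>a\<close> in \<open>L\<close> and \<open>b\<close>
      in \<open>H\<close> would satisfy \<open>z \<le> a < b \<le> z\<close>.\<close>
    have "above z \<or> below z" for z
      using LH(5) by (auto simp: above_def below_def not_less) (meson order.strict_trans2)
    then have "length (filter (\<lambda>z. \<not> above z) ys) \<le> length (filter below ys)" for ys
      by (induction ys) (auto simp: le_SucI)
    then show ?thesis
      using sum_length_filter_compl[of above "take h xs"] xs
      by (metis add_left_mono length_take min.absorb2)
  qed
  \<comment> \<open>The two gains sum to at least \<open>h\<close>, so the larger is at least
    \<open>(h + 1) div 2\<close>, which is \<open>h / 2\<close> rounded up.\<close>
  ultimately show ?thesis by (auto simp: h_def)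
qed

text \<open>If at most \<open>2 * M\<close> elements were pending, at most two runs would remain.
  Hence a run followed by two others starts with more than \<open>2 * M\<close> pending, enough for
  the bound on the longer candidate.\<close>

lemma greedy_run_ge:
  fixes s :: "'a::linorder state"
  assumes "greedy_runs s rs" "buffer_inv M s" "i + 2 < length rs"
  shows "M + (M div 2 + 1) div 2 \<le> length (rs ! i)"
  using assms
proof (induction arbitrary: i rule: greedy_runs.induct)
  case finished
  then show ?case by simp
next
  case (up s u su d sd rs)
  have "2 * M < size (pending s)"
    using length_greedy_runs_le[OF greedy_runs.up[OF up.hyps(1-4)] up.prems(1), of 2] up.prems(2)
    by linarith
  with longer_run_ge[OF up.hyps(1,2) up.prems(1)] up.hyps(3)
    up.IH[OF maximal_run_pending(2)[OF up.hyps(1) up.prems(1)]] up.prems(2)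
  show ?case by (cases i) auto
next
  case (down s u su d sd rs)
  have "2 * M < size (pending s)"
    using length_greedy_runs_le[OF greedy_runs.down[OF down.hyps(1-4)] down.prems(1), of 2]
      down.prems(2)
    by linarith
  with longer_run_ge[OF down.hyps(1,2) down.prems(1)] down.hyps(3)
    down.IH[OF maximal_run_pending(2)[OF down.hyps(2) down.prems(1)]] down.prems(2)
  show ?case by (cases i) auto
qed

lemma buffer_inv_init_state:
  assumes "distinct I"
  shows "buffer_inv M (init_state M I)"
proof -
  have "pending (init_state M I) = mset I"
    by (metis append_take_drop_id fst_conv init_state_def mset_append pending_def snd_conv)
  moreover have "count (mset I) y \<le> 1" for y
    using assms by (simp add: distinct_count_atmost_1)
  ultimately show ?thesis by (auto simp: buffer_inv_def init_state_def)
qed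

theorem theorem6:
  fixes I :: "'a::linorder list" and M :: nat and rs :: "'a list list" and i :: nat
  assumes "distinct I"
    and "greedy_output M I rs"
    and "i + 2 < length rs"
  shows "int (length (rs ! i)) \<ge> int M + \<lceil>real_of_int \<lfloor>real M / 2\<rfloor> / 2\<rceil>"
proof -
  have "\<lfloor>real M / 2\<rfloor> = int (M div 2)"
    using floor_divide_of_nat_eq[of M 2, where 'a = real] by simp
  moreover have "\<lceil>real_of_int (int n) / 2\<rceil> \<le> int ((n + 1) div 2)" for n
  proof -
    have "n \<le> 2 * ((n + 1) div 2)" by simp
    then have "real n \<le> 2 * real ((n + 1) div 2)" by linarith
    then show ?thesis by (simp add: ceiling_le_iff)
  qed
  ultimately have "\<lceil>real_of_int \<lfloor>real M / 2\<rfloor> / 2\<rceil> \<le> int ((M div 2 + 1) div 2)"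
    by metis
  moreover have "M + (M div 2 + 1) div 2 \<le> length (rs ! i)"
    using greedy_run_ge[OF _ buffer_inv_init_state[OF assms(1)] assms(3)] assms(2)
    by (simp add: greedy_output_def)
  ultimately show ?thesis by linarith
qed

end
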